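(* Let $\sigma_0,\sigma_1,\dots,\sigma_n,\dots$ be a sequence of positive numbers, and let $Z=(Z[0],\dots,Z[n])$, where $Z[0],Z[1],\dots,Z[n],\dots$ are independent random variables with $Z[j]\sim N(0,\sigma_j^2)$. Suppose too that $\sigma>0$ satisfies $$\frac1n\sum_{j=1}^n\sigma_j^2\le\sigma^2$$ for all $n$. Let $t>0$. Then for all $1\le p\le\infty$, $$\mathbb{P}\left\{\|Z\|_{\nu_p}\ge t\right\}\le Ae^{-Bt^2n/\sigma^2},$$ where $A>0$ and $B>0$ are universal constants; $$\lim_{n\to\infty}\|Z\|_{\nu_p}=0$$ almost surely; and $$\mathbb{E}\|Z\|_{\nu_p}\le C\frac{\sigma}{\sqrt n},$$ where $C>0$ is a universal constant. Furthermore, these three statements hold with $Z$ replaced by $Z_{\mathrm{cen}}$.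
   Context: Here $[a,b]$ is an interval with $a<b$, $n$ denotes a positive integer, and $Z\in\mathbb{R}^{n+1}$. Discrete norms: for $\mathbf{v}\in\mathbb{R}^{n+1}$ (entries indexed $0,\dots,n$), $$\|\mathbf{v}\|_{\tau_p}=\left(\frac{b-a}{2n}\sum_{k=0}^{n-1}\left(|\mathbf{v}[k]|^p+|\mathbf{v}[k+1]|^p\right)\right)^{1/p}\ (1\le p<\infty),\qquad \|\mathbf{v}\|_{\tau_\infty}=\max_{0\le k\le n}|\mathbf{v}[k]|.$$ The discrete Volterra operator $\mathbf{V}:\mathbb{R}^{n+1}\to\mathbb{R}^{n+1}$ is $(\mathbf{V}\mathbf{x})[0]=0$ and $(\mathbf{V}\mathbf{x})[k]=\frac{b-a}{2n}\sum_{j=0}^{k-1}(\mathbf{x}[j]+\mathbf{x}[j+1])$ for $1\le k\le n$; and $\|\mathbf{x}\|_{\nu_p}=\|\mathbf{V}\mathbf{x}\|_{\tau_p}$. Centering: for $\mathbf{w}\in\mathbb{R}^{n+1}$, $\mathrm{m}(\mathbf{w})=\frac1{2n}\sum_{k=0}^{n-1}(\mathbf{w}[k]+\mathbf{w}[k+1])$ and $\mathbf{w}_{\mathrm{cen}}[k]=\mathbf{w}[k]-\mathrm{m}(\mathbf{w})$, $0\le k\le n$.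
   Formalization: The formal theorem adds σ_0 ≤ Kσ for an arbitrary K and lets A, B, C depend on K and on a, b; as written the bounds fail when σ_0 → ∞, since the variance condition omits σ_0, and when b−a → ∞. The sample-space type is fixed before the constants, which pushing forward to sequence space removes. *)

theory Defs
  imports "HOL-Probability.Probability"
begin

text \<open>
  A vector in \<open>\<real>\<close>-to-the-\<open>(n+1)\<close> with entries indexed \<open>0,\<dots>,n\<close> is represented by a function
  \<open>nat \<Rightarrow> real\<close> together with \<open>n\<close>; values at indices above \<open>n\<close> are never inspected by the norms
  below. This lets one sequence supply the vectors for every \<open>n\<close>.
\<close>

text \<open>The exponent ranges over \<open>[1,\<infinity>]\<close>, hence the type \<open>ereal\<close>.\<close>

definition tau_norm :: "real \<Rightarrow> real \<Rightarrow> nat \<Rightarrow> ereal \<Rightarrow> (nat \<Rightarrow> real) \<Rightarrow> real" where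
  "tau_norm a b n p v =
     (if p = \<infinity> then Max ((\<lambda>k. \<bar>v k\<bar>) ` {0..n})
      else ((b - a) / (2 * real n) *
              (\<Sum>k<n. \<bar>v k\<bar> powr real_of_ereal p + \<bar>v (k + 1)\<bar> powr real_of_ereal p))
           powr (1 / real_of_ereal p))"

text \<open>For \<open>k = 0\<close> the sum is empty, so the value is \<open>0\<close>.\<close>

definition volterra :: "real \<Rightarrow> real \<Rightarrow> nat \<Rightarrow> (nat \<Rightarrow> real) \<Rightarrow> nat \<Rightarrow> real" where
  "volterra a b n x k = (b - a) / (2 * real n) * (\<Sum>j<k. x j + x (j + 1))"

definition nu_norm :: "real \<Rightarrow> real \<Rightarrow> nat \<Rightarrow> ereal \<Rightarrow> (nat \<Rightarrow> real) \<Rightarrow> real" where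
  "nu_norm a b n p x = tau_norm a b n p (volterra a b n x)"

definition trap_mean :: "nat \<Rightarrow> (nat \<Rightarrow> real) \<Rightarrow> real" where
  "trap_mean n w = 1 / (2 * real n) * (\<Sum>k<n. w k + w (k + 1))"

definition centered :: "nat \<Rightarrow> (nat \<Rightarrow> real) \<Rightarrow> nat \<Rightarrow> real" where
  "centered n w k = w k - trap_mean n w"

end

theory Submission imports Defs
begin

text \<open>
  For \<open>k \<ge> 1\<close>, \<open>volterra a b n x k\<close> is \<open>(b - a) / (2 * n)\<close> times
  \<open>x 0 + S (k - 1) + S k\<close>, where \<open>S k\<close> is the sum of \<open>x 1, \<dots>, x k\<close>. Every discrete
  \<open>p\<close>-norm is at most \<open>max 1 (b - a)\<close> times the maximum norm, because
  \<open>(b - a)\<close> raised to \<open>1 / p\<close> never exceeds that number, and centering at most doubles the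
  maximum of the Volterra sums. Hence all the norms in question, for every \<open>p\<close> at once, are
  controlled by the ratio of \<open>max \<bar>x 0\<bar> (MAX k. \<bar>S k\<bar>)\<close> to \<open>n\<close> (lemma \<open>nu_norm_le\<close>).

  For Gaussian noise the end of the walk \<open>S n\<close> is a centered normal variable of variance at
  most \<open>n * \<sigma>\<^sup>2\<close>. Levy's maximal inequality (\<open>levy_maximal_inequality\<close>) transfers its tail
  bound to the maximum of the walk at the price of a factor two; a union bound over \<open>k\<close>
  would lose a factor \<open>n\<close>. A level \<open>t\<close> for the norm corresponds to a level of order \<open>t * n\<close>
  for the walk, and \<open>(t * n)\<^sup>2 / (n * \<sigma>\<^sup>2) = t\<^sup>2 * n / \<sigma>\<^sup>2\<close> is the exponent claimed. The
  entry \<open>Z 0\<close> is not covered by the variance condition; the hypothesis \<open>s 0 \<le> K * \<sigma>\<close>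
  bounds its variance, and with it its tail, in terms of \<open>\<sigma>\<close>.

  The other two claims follow from the tail bound alone. It is summable in \<open>n\<close>, so the first
  Borel-Cantelli lemma gives almost sure convergence, and in units of \<open>\<sigma> / sqrt n\<close> it does not
  depend on \<open>n\<close>, so summing it over integer levels bounds the expectation.
\<close>

section \<open>Gaussian tails\<close>

lemma (in prob_space) normal_nonneg_prob_ge_half:
  fixes X :: "'a \<Rightarrow> real"
  assumes X: "distributed M lborel X (normal_density 0 s)" and s: "0 < s"
  shows "1 / 2 \<le> prob {\<omega> \<in> space M. 0 \<le> X \<omega>}"
proof -
  have [measurable]: "X \<in> borel_measurable M"
    using distributed_measurable[OF X] by simp
  have "distributed M lborel (\<lambda>\<omega>. 0 + (-1) * X \<omega>) (normal_density (0 + (-1) * 0) (\<bar>-1\<bar> * s))"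
    by (rule normal_density_affine[OF X s]) simp
  then have neg: "distributed M lborel (\<lambda>\<omega>. - X \<omega>) (normal_density 0 s)"
    by simp
  have "distr M lborel X = distr M lborel (\<lambda>\<omega>. - X \<omega>)"
    using distributed_distr_eq_density[OF X] distributed_distr_eq_density[OF neg] by simp
  then have "measure (distr M lborel X) {0..} = measure (distr M lborel (\<lambda>\<omega>. - X \<omega>)) {0..}"
    by simp
  then have "prob {\<omega> \<in> space M. 0 \<le> X \<omega>} = prob {\<omega> \<in> space M. X \<omega> \<le> 0}"
    by (simp add: measure_distr vimage_def Int_def conj_commute)
  moreover have "1 \<le> prob {\<omega> \<in> space M. 0 \<le> X \<omega>} + prob {\<omega> \<in> space M. X \<omega> \<le> 0}"
  proof -
    have "{\<omega> \<in> space M. 0 \<le> X \<omega>} \<union> {\<omega> \<in> space M. X \<omega> \<le> 0} = space M"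
      by auto
    then show ?thesis
      using measure_Un_le[of "{\<omega> \<in> space M. 0 \<le> X \<omega>}" M "{\<omega> \<in> space M. X \<omega> \<le> 0}"]
      by (simp add: prob_space)
  qed
  ultimately show ?thesis by simp
qed

text \<open>
  On \<open>{t..}\<close> the density is at most \<open>exp (- t\<^sup>2 / (2 * s\<^sup>2))\<close> times the normal density with
  mean \<open>t\<close>, whose total mass is one.
\<close>

lemma (in prob_space) normal_tail_le:
  fixes X :: "'a \<Rightarrow> real"
  assumes X: "distributed M lborel X (normal_density 0 s)" and s: "0 < s" and t: "0 \<le> t"
  shows "prob {\<omega> \<in> space M. t \<le> X \<omega>} \<le> exp (- t\<^sup>2 / (2 * s\<^sup>2))"
proof -
  have "emeasure M {\<omega> \<in> space M. t \<le> X \<omega>} = emeasure M (X -` {t..} \<inter> space M)"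
    by (rule arg_cong[where f = "emeasure M"]) auto
  also have "\<dots> = (\<integral>\<^sup>+x. ennreal (normal_density 0 s x) * indicator {t..} x \<partial>lborel)"
    by (rule distributed_emeasure[OF X]) simp
  also have "\<dots> \<le> (\<integral>\<^sup>+x. ennreal (exp (- t\<^sup>2 / (2 * s\<^sup>2))) * ennreal (normal_density t s x) \<partial>lborel)"
  proof (rule nn_integral_mono)
    fix x :: real
    have "normal_density 0 s x \<le> exp (- t\<^sup>2 / (2 * s\<^sup>2)) * normal_density t s x" if "t \<le> x"
    proof -
      \<comment> \<open>\<open>x\<^sup>2 = t\<^sup>2 + (x - t)\<^sup>2 + 2 t (x - t)\<close>, and the cross term is nonnegative.\<close>
      have "0 \<le> t * (x - t)"
        using t that by simp
      then have "t\<^sup>2 + (x - t)\<^sup>2 \<le> x\<^sup>2"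
        by (simp add: power2_eq_square algebra_simps)
      then have "- x\<^sup>2 / (2 * s\<^sup>2) \<le> - t\<^sup>2 / (2 * s\<^sup>2) + - (x - t)\<^sup>2 / (2 * s\<^sup>2)"
        using s by (simp add: divide_simps)
      then have "exp (- x\<^sup>2 / (2 * s\<^sup>2)) \<le> exp (- t\<^sup>2 / (2 * s\<^sup>2)) * exp (- (x - t)\<^sup>2 / (2 * s\<^sup>2))"
        unfolding exp_add[symmetric] by (rule exp_le_cancel_iff[THEN iffD2])
      then have "1 / sqrt (2 * pi * s\<^sup>2) * exp (- x\<^sup>2 / (2 * s\<^sup>2))
          \<le> 1 / sqrt (2 * pi * s\<^sup>2) * (exp (- t\<^sup>2 / (2 * s\<^sup>2)) * exp (- (x - t)\<^sup>2 / (2 * s\<^sup>2)))"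
        by (intro mult_left_mono) auto
      then show ?thesis
        unfolding normal_density_def by (simp add: mult_ac)
    qed
    then show "ennreal (normal_density 0 s x) * indicator {t..} x
        \<le> ennreal (exp (- t\<^sup>2 / (2 * s\<^sup>2))) * ennreal (normal_density t s x)"
      by (auto simp: ennreal_mult[symmetric] indicator_def intro!: ennreal_leI)
  qed
  also have "\<dots> = ennreal (exp (- t\<^sup>2 / (2 * s\<^sup>2))) * (\<integral>\<^sup>+x. ennreal (normal_density t s x) \<partial>lborel)"
    by (rule nn_integral_cmult) simp
  also have "(\<integral>\<^sup>+x. ennreal (normal_density t s x) \<partial>lborel) = 1"
    by (subst nn_integral_eq_integral) (use s in auto)
  finally show ?thesis
    by (simp add: emeasure_eq_measure)
qed

lemma (in prob_space) normal_abs_tail_le: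
  fixes X :: "'a \<Rightarrow> real"
  assumes X: "distributed M lborel X (normal_density 0 s)" and s: "0 < s" and t: "0 \<le> t"
  shows "prob {\<omega> \<in> space M. t \<le> \<bar>X \<omega>\<bar>} \<le> 2 * exp (- t\<^sup>2 / (2 * s\<^sup>2))"
proof -
  have [measurable]: "X \<in> borel_measurable M"
    using distributed_measurable[OF X] by simp
  have "distributed M lborel (\<lambda>\<omega>. 0 + (-1) * X \<omega>) (normal_density (0 + (-1) * 0) (\<bar>-1\<bar> * s))"
    by (rule normal_density_affine[OF X s]) simp
  then have neg: "distributed M lborel (\<lambda>\<omega>. - X \<omega>) (normal_density 0 s)"
    by simp
  have "{\<omega> \<in> space M. t \<le> \<bar>X \<omega>\<bar>} = {\<omega> \<in> space M. t \<le> X \<omega>} \<union> {\<omega> \<in> space M. t \<le> - X \<omega>}"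
    by auto
  then have "prob {\<omega> \<in> space M. t \<le> \<bar>X \<omega>\<bar>}
      \<le> prob {\<omega> \<in> space M. t \<le> X \<omega>} + prob {\<omega> \<in> space M. t \<le> - X \<omega>}"
    by (simp add: measure_Un_le)
  then show ?thesis
    using normal_tail_le[OF X s t] normal_tail_le[OF neg s t] by simp
qed

section \<open>A maximal inequality for partial sums\<close>

text \<open>
  Split according to the first index \<open>k\<close> at which the partial
  sum reaches \<open>t\<close>. That event depends on the first \<open>k\<close> variables only, and independently of it
  the remaining increment is nonnegative with probability at least one half, in which case the
  full sum is still at least \<open>t\<close>.
\<close>

lemma (in prob_space) levy_maximal_inequality:
  fixes X :: "nat \<Rightarrow> 'a \<Rightarrow> real"
  assumes indep: "indep_vars (\<lambda>_. borel) X {1..n}"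
    and half: "\<And>k. k < n \<Longrightarrow> 1 / 2 \<le> prob {\<omega> \<in> space M. 0 \<le> (\<Sum>j=Suc k..n. X j \<omega>)}"
  shows "prob {\<omega> \<in> space M. \<exists>k\<in>{1..n}. t \<le> (\<Sum>j=1..k. X j \<omega>)}
    \<le> 2 * prob {\<omega> \<in> space M. t \<le> (\<Sum>j=1..n. X j \<omega>)}"
proof -
  define S where "S k \<omega> = (\<Sum>j=1..k. X j \<omega>)" for k \<omega>
  define A where "A k = {\<omega> \<in> space M. t \<le> S k \<omega> \<and> (\<forall>i\<in>{1..<k}. S i \<omega> < t)}" for k
  define T where "T k = {\<omega> \<in> space M. 0 \<le> (\<Sum>j=Suc k..n. X j \<omega>)}" for k
  have X_meas: "X j \<in> borel_measurable M" if "j \<in> {1..n}" for j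
    using indep that by (auto simp: indep_vars_def)
  have S_meas: "S k \<in> borel_measurable M" if "k \<le> n" for k
    unfolding S_def using that by (intro borel_measurable_sum X_meas) auto
  have A_sets: "A k \<in> events" if "k \<in> {1..n}" for k
  proof -
    have "Measurable.pred M (\<lambda>\<omega>. S i \<omega> < t)" if "i \<in> {1..<k}" for i
    proof -
      have [measurable]: "S i \<in> borel_measurable M"
        using that \<open>k \<in> {1..n}\<close> by (intro S_meas) auto
      show ?thesis by measurable
    qed
    then have [measurable]: "Measurable.pred M (\<lambda>\<omega>. \<forall>i\<in>{1..<k}. S i \<omega> < t)"
      by (intro pred_intros_finite) auto
    have [measurable]: "S k \<in> borel_measurable M"
      using that by (intro S_meas) auto
    show ?thesis
      unfolding A_def by measurable
  qed
  have T_sets: "T k \<in> events" for k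
  proof -
    have "(\<lambda>\<omega>. \<Sum>j=Suc k..n. X j \<omega>) \<in> borel_measurable M"
      by (intro borel_measurable_sum X_meas) auto
    then show ?thesis
      unfolding T_def by measurable
  qed
  have A_disj: "disjoint_family_on A {1..n}"
    unfolding disjoint_family_on_def A_def
  proof (intro ballI impI)
    fix k l assume "k \<in> {1..n}" "l \<in> {1..n}" "k \<noteq> l"
    then have "k \<in> {1..<l} \<or> l \<in> {1..<k}"
      by auto
    then show "{\<omega> \<in> space M. t \<le> S k \<omega> \<and> (\<forall>i\<in>{1..<k}. S i \<omega> < t)} \<inter>
        {\<omega> \<in> space M. t \<le> S l \<omega> \<and> (\<forall>i\<in>{1..<l}. S i \<omega> < t)} = {}"
      by force
  qed
  have cover: "{\<omega> \<in> space M. \<exists>k\<in>{1..n}. t \<le> S k \<omega>} = (\<Union>k\<in>{1..n}. A k)"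
  proof (intro equalityI subsetI)
    fix \<omega> assume "\<omega> \<in> {\<omega> \<in> space M. \<exists>k\<in>{1..n}. t \<le> S k \<omega>}"
    then have ex: "\<exists>k. k \<in> {1..n} \<and> t \<le> S k \<omega>" and \<omega>: "\<omega> \<in> space M"
      by auto
    define k where "k = (LEAST k. k \<in> {1..n} \<and> t \<le> S k \<omega>)"
    have k: "k \<in> {1..n} \<and> t \<le> S k \<omega>"
      unfolding k_def by (rule LeastI_ex[OF ex])
    moreover have "S i \<omega> < t" if "i \<in> {1..<k}" for i
      using not_less_Least[of i "\<lambda>k. k \<in> {1..n} \<and> t \<le> S k \<omega>"] that k unfolding k_def[symmetric]
      by auto
    ultimately show "\<omega> \<in> (\<Union>k\<in>{1..n}. A k)"
      using \<omega> by (auto simp: A_def)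
  qed (auto simp: A_def)
  have indep_AT: "prob (A k \<inter> T k) = prob (A k) * prob (T k)" if k: "k \<in> {1..n}" for k
  proof -
    let ?P = "PiM {1..k} (\<lambda>_. borel :: real measure)"
    let ?Q = "PiM {Suc k..n} (\<lambda>_. borel :: real measure)"
    define A' where "A' = {f \<in> space ?P. t \<le> (\<Sum>j=1..k. f j) \<and> (\<forall>i\<in>{1..<k}. (\<Sum>j=1..i. f j) < t)}"
    define T' where "T' = {f \<in> space ?Q. 0 \<le> (\<Sum>j=Suc k..n. f j)}"
    have sum_meas: "(\<lambda>f. \<Sum>j=1..i. f j) \<in> borel_measurable ?P" if "i \<le> k" for i
      using that by (intro borel_measurable_sum measurable_component_singleton) auto
    have "Measurable.pred ?P (\<lambda>f. (\<Sum>j=1..i. f j) < t)" if "i \<in> {1..<k}" for i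
    proof -
      have [measurable]: "(\<lambda>f. \<Sum>j=1..i. f j) \<in> borel_measurable ?P"
        using that by (intro sum_meas) auto
      show ?thesis by measurable
    qed
    then have "Measurable.pred ?P (\<lambda>f. \<forall>i\<in>{1..<k}. (\<Sum>j=1..i. f j) < t)"
      by (intro pred_intros_finite) auto
    then have A': "A' \<in> sets ?P"
      unfolding A'_def using sum_meas[OF order_refl] by measurable
    have "(\<lambda>f. \<Sum>j=Suc k..n. f j) \<in> borel_measurable ?Q"
      by (intro borel_measurable_sum measurable_component_singleton) auto
    then have T': "T' \<in> sets ?Q"
      unfolding T'_def by measurable
    have iv: "indep_var ?P (\<lambda>\<omega>. restrict (\<lambda>i. X i \<omega>) {1..k}) ?Q (\<lambda>\<omega>. restrict (\<lambda>i. X i \<omega>) {Suc k..n})"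
      using k by (intro indep_var_restrict[OF indep]) auto
    have A_eq: "(\<lambda>\<omega>. restrict (\<lambda>i. X i \<omega>) {1..k}) -` A' \<inter> space M = A k"
      by (auto simp: A_def A'_def S_def space_PiM)
    have T_eq: "(\<lambda>\<omega>. restrict (\<lambda>i. X i \<omega>) {Suc k..n}) -` T' \<inter> space M = T k"
      by (auto simp: T_def T'_def space_PiM)
    have "(\<lambda>\<omega>. (restrict (\<lambda>i. X i \<omega>) {1..k}, restrict (\<lambda>i. X i \<omega>) {Suc k..n})) -` (A' \<times> T') \<inter> space M
        = A k \<inter> T k"
      unfolding A_eq[symmetric] T_eq[symmetric] by auto
    then show ?thesis
      using indep_varD[OF iv A' T'] unfolding A_eq T_eq by simp
  qed
  have T_half: "1 / 2 \<le> prob (T k)" if "k \<in> {1..n}" for k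
    using half[of k] that by (cases "k = n") (auto simp: T_def prob_space)
  have "prob {\<omega> \<in> space M. \<exists>k\<in>{1..n}. t \<le> S k \<omega>} = (\<Sum>k\<in>{1..n}. prob (A k))"
    unfolding cover using A_sets A_disj by (intro finite_measure_finite_Union) auto
  also have "\<dots> \<le> (\<Sum>k\<in>{1..n}. 2 * prob (A k \<inter> T k))"
  proof (rule sum_mono)
    fix k assume k: "k \<in> {1..n}"
    show "prob (A k) \<le> 2 * prob (A k \<inter> T k)"
      using mult_left_mono[OF T_half[OF k], of "prob (A k)"] indep_AT[OF k] by simp
  qed
  also have "\<dots> = 2 * prob (\<Union>k\<in>{1..n}. A k \<inter> T k)"
    unfolding sum_distrib_left[symmetric]
  proof (rule arg_cong[where f = "(*) 2"], rule finite_measure_finite_Union[symmetric])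
    show "disjoint_family_on (\<lambda>k. A k \<inter> T k) {1..n}"
      using A_disj by (rule disjoint_family_on_bisimulation) blast
  qed (use A_sets T_sets in auto)
  also have "prob (\<Union>k\<in>{1..n}. A k \<inter> T k) \<le> prob {\<omega> \<in> space M. t \<le> S n \<omega>}"
  proof (rule finite_measure_mono)
    show "{\<omega> \<in> space M. t \<le> S n \<omega>} \<in> events"
      using S_meas[OF order_refl] by measurable
    show "(\<Union>k\<in>{1..n}. A k \<inter> T k) \<subseteq> {\<omega> \<in> space M. t \<le> S n \<omega>}"
    proof
      fix \<omega> assume "\<omega> \<in> (\<Union>k\<in>{1..n}. A k \<inter> T k)"
      then obtain k where k: "k \<in> {1..n}" "\<omega> \<in> A k" "\<omega> \<in> T k"
        by auto
      have "{1..n} = {1..k} \<union> {Suc k..n}"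
        using k(1) by auto
      then have "S n \<omega> = S k \<omega> + (\<Sum>j=Suc k..n. X j \<omega>)"
        unfolding S_def by (simp add: sum.union_disjoint)
      then show "\<omega> \<in> {\<omega> \<in> space M. t \<le> S n \<omega>}"
        using k(2,3) by (auto simp: A_def T_def)
    qed
  qed
  finally show ?thesis
    by (simp add: S_def)
qed

text \<open>
  Levy's inequality controls the maximum from above only; applying it to \<open>X\<close> and to \<open>- X\<close>
  gives the absolute values, which turns its factor two into four.
\<close>

lemma (in prob_space) normal_partial_sums_tail:
  fixes X :: "nat \<Rightarrow> 'a \<Rightarrow> real"
  assumes indep: "indep_vars (\<lambda>_. borel) X {1..n}" and n: "1 \<le> n"
    and s: "\<And>j. j \<in> {1..n} \<Longrightarrow> 0 < s j"
    and X: "\<And>j. j \<in> {1..n} \<Longrightarrow> distributed M lborel (X j) (normal_density 0 (s j))"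
    and t: "0 \<le> t"
  shows "prob {\<omega> \<in> space M. \<exists>k\<in>{1..n}. t \<le> \<bar>\<Sum>j=1..k. X j \<omega>\<bar>}
    \<le> 4 * exp (- t\<^sup>2 / (2 * (\<Sum>j=1..n. (s j)\<^sup>2)))"
proof -
  have one_sided: "prob {\<omega> \<in> space M. \<exists>k\<in>{1..n}. t \<le> (\<Sum>j=1..k. Y j \<omega>)}
      \<le> 2 * exp (- t\<^sup>2 / (2 * (\<Sum>j=1..n. (s j)\<^sup>2)))"
    if Y_indep: "indep_vars (\<lambda>_. borel) Y {1..n}"
      and Y: "\<And>j. j \<in> {1..n} \<Longrightarrow> distributed M lborel (Y j) (normal_density 0 (s j))"
    for Y :: "nat \<Rightarrow> 'a \<Rightarrow> real"
  proof -
    have sum_normal: "distributed M lborel (\<lambda>\<omega>. \<Sum>j=Suc k..n. Y j \<omega>)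
        (normal_density 0 (sqrt (\<Sum>j=Suc k..n. (s j)\<^sup>2)))" if "k < n" for k
      using sum_indep_normal[of "{Suc k..n}" Y s "\<lambda>_. 0"] that s Y
        indep_vars_subset[OF Y_indep, of "{Suc k..n}"] by simp
    have sd_pos: "0 < sqrt (\<Sum>j=Suc k..n. (s j)\<^sup>2)" if "k < n" for k
    proof -
      have "0 < (s j)\<^sup>2" if "j \<in> {Suc k..n}" for j
        using s[of j] that by simp
      then show ?thesis
        using that by (auto intro!: sum_pos)
    qed
    have "prob {\<omega> \<in> space M. \<exists>k\<in>{1..n}. t \<le> (\<Sum>j=1..k. Y j \<omega>)}
        \<le> 2 * prob {\<omega> \<in> space M. t \<le> (\<Sum>j=1..n. Y j \<omega>)}"
      by (intro levy_maximal_inequality Y_indep normal_nonneg_prob_ge_half[OF sum_normal sd_pos])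
    also have "prob {\<omega> \<in> space M. t \<le> (\<Sum>j=1..n. Y j \<omega>)}
        \<le> exp (- t\<^sup>2 / (2 * (sqrt (\<Sum>j=1..n. (s j)\<^sup>2))\<^sup>2))"
      using normal_tail_le[OF sum_normal[of 0] sd_pos[of 0] t] n by simp
    finally show ?thesis
      by (simp add: sum_nonneg)
  qed
  have X_meas: "X j \<in> borel_measurable M" if "j \<in> {1..n}" for j
    using indep that by (auto simp: indep_vars_def)
  have neg_indep: "indep_vars (\<lambda>_. borel) (\<lambda>j \<omega>. - X j \<omega>) {1..n}"
    using indep_vars_compose2[OF indep, of "\<lambda>_ x. - x" "\<lambda>_. borel"] by simp
  have neg: "distributed M lborel (\<lambda>\<omega>. - X j \<omega>) (normal_density 0 (s j))" if "j \<in> {1..n}" for j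
    using normal_density_affine[OF X[OF that] s[OF that], of "-1" 0] by simp
  have meas: "{\<omega> \<in> space M. \<exists>k\<in>{1..n}. t \<le> (\<Sum>j=1..k. Y j \<omega>)} \<in> events"
    if "\<And>j. j \<in> {1..n} \<Longrightarrow> Y j \<in> borel_measurable M" for Y :: "nat \<Rightarrow> 'a \<Rightarrow> real"
  proof -
    have "{\<omega> \<in> space M. t \<le> (\<Sum>j=1..k. Y j \<omega>)} \<in> events" if "k \<in> {1..n}" for k
    proof -
      have "(\<lambda>\<omega>. \<Sum>j=1..k. Y j \<omega>) \<in> borel_measurable M"
        using that \<open>\<And>j. j \<in> {1..n} \<Longrightarrow> Y j \<in> borel_measurable M\<close> by (intro borel_measurable_sum) auto
      then show ?thesis by measurable
    qed
    then have "(\<Union>k\<in>{1..n}. {\<omega> \<in> space M. t \<le> (\<Sum>j=1..k. Y j \<omega>)}) \<in> events"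
      by auto
    also have "(\<Union>k\<in>{1..n}. {\<omega> \<in> space M. t \<le> (\<Sum>j=1..k. Y j \<omega>)})
        = {\<omega> \<in> space M. \<exists>k\<in>{1..n}. t \<le> (\<Sum>j=1..k. Y j \<omega>)}"
      by auto
    finally show ?thesis .
  qed
  let ?E = "\<lambda>Y :: nat \<Rightarrow> 'a \<Rightarrow> real. {\<omega> \<in> space M. \<exists>k\<in>{1..n}. t \<le> (\<Sum>j=1..k. Y j \<omega>)}"
  have abs_ge: "t \<le> \<bar>x\<bar> \<longleftrightarrow> t \<le> x \<or> t \<le> - x" for x :: real
    by linarith
  have split: "{\<omega> \<in> space M. \<exists>k\<in>{1..n}. t \<le> \<bar>\<Sum>j=1..k. X j \<omega>\<bar>} = ?E X \<union> ?E (\<lambda>j \<omega>. - X j \<omega>)"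
    unfolding sum_negf abs_ge by (simp add: bex_disj_distrib conj_disj_distribL Collect_disj_eq)
  have "prob (?E X \<union> ?E (\<lambda>j \<omega>. - X j \<omega>)) \<le> prob (?E X) + prob (?E (\<lambda>j \<omega>. - X j \<omega>))"
    by (intro measure_Un_le meas) (auto simp: X_meas)
  then show ?thesis
    unfolding split using one_sided[OF indep X] one_sided[OF neg_indep neg] by simp
qed

section \<open>Consequences of a Gaussian tail bound\<close>

lemma (in prob_space) AE_tendsto_zero_of_gaussian_tails:
  fixes Y :: "nat \<Rightarrow> 'a \<Rightarrow> real"
  assumes [measurable]: "\<And>n. Y n \<in> borel_measurable M" and Y0: "\<And>n \<omega>. 0 \<le> Y n \<omega>"
    and c: "0 < c"
    and tail: "\<And>n t. 1 \<le> n \<Longrightarrow> 0 < t \<Longrightarrow>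
      prob {\<omega> \<in> space M. t \<le> Y n \<omega>} \<le> A * exp (- c * t\<^sup>2 * real n)"
  shows "AE \<omega> in M. (\<lambda>n. Y n \<omega>) \<longlonglongrightarrow> 0"
proof -
  have small: "AE \<omega> in M. \<forall>\<^sub>F n in sequentially. Y n \<omega> < t" if t: "0 < t" for t
  proof -
    have "exp (- c * t\<^sup>2) < 1"
      using c t by simp
    then have "summable (\<lambda>n. A * exp (- c * t\<^sup>2) ^ n)"
      by (intro summable_mult summable_geometric) simp
    then have "summable (\<lambda>n. prob {\<omega> \<in> space M. t \<le> Y n \<omega>})"
    proof (rule summable_comparison_test'[where N = 1])
      fix n :: nat assume "1 \<le> n"
      then show "norm (prob {\<omega> \<in> space M. t \<le> Y n \<omega>}) \<le> A * exp (- c * t\<^sup>2) ^ n"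
        using tail[OF _ t, of n] by (simp add: exp_of_nat_mult[symmetric] mult_ac)
    qed
    then have "AE \<omega> in M. \<forall>\<^sub>F n in sequentially. \<omega> \<in> space M - {\<omega> \<in> space M. t \<le> Y n \<omega>}"
      by (intro borel_cantelli_AE1) (auto simp: emeasure_eq_measure)
    then show ?thesis
      by eventually_elim (auto elim!: eventually_mono)
  qed
  have "AE \<omega> in M. \<forall>m. \<forall>\<^sub>F n in sequentially. Y n \<omega> < 1 / real (Suc m)"
    unfolding AE_all_countable by (intro allI small) simp
  then show ?thesis
  proof eventually_elim
    fix \<omega> assume ev: "\<forall>m. \<forall>\<^sub>F n in sequentially. Y n \<omega> < 1 / real (Suc m)"
    show "(\<lambda>n. Y n \<omega>) \<longlonglongrightarrow> 0"
    proof (rule tendstoI)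
      fix e :: real assume "0 < e"
      then obtain m where "1 / real (Suc m) < e"
        using nat_approx_posE by blast
      with ev[rule_format, of m] show "\<forall>\<^sub>F n in sequentially. dist (Y n \<omega>) 0 < e"
        using Y0 by (auto elim!: eventually_mono)
    qed
  qed
qed

text \<open>
  The bound comes from the discrete layer-cake estimate
  \<open>X \<le> d * (1 + (\<Sum>m. indicator {(m + 1) * d \<le> X}))\<close>, whose expectation is dominated by a
  geometric series because \<open>(m + 1)\<^sup>2 \<ge> m + 1\<close>.
\<close>

lemma (in prob_space) expectation_le_of_gaussian_tail:
  fixes Y :: "'a \<Rightarrow> real"
  assumes [measurable]: "Y \<in> borel_measurable M" and Y0: "\<And>\<omega>. 0 \<le> Y \<omega>"
    and d: "0 < d" and B: "0 < B" and A: "0 \<le> A"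
    and tail: "\<And>t. 0 < t \<Longrightarrow> prob {\<omega> \<in> space M. t \<le> Y \<omega>} \<le> A * exp (- B * (t / d)\<^sup>2)"
  shows "integrable M Y" and "expectation Y \<le> (1 + A / B) * d"
proof -
  define E where "E m = {\<omega> \<in> space M. real (Suc m) * d \<le> Y \<omega>}" for m
  have [measurable]: "E m \<in> events" for m
    unfolding E_def by measurable
  have layer: "ennreal (Y \<omega>) \<le> ennreal d * (1 + (\<Sum>m. indicator (E m) \<omega>))" if "\<omega> \<in> space M" for \<omega>
  proof -
    define N where "N = nat \<lfloor>Y \<omega> / d\<rfloor>"
    have "0 \<le> Y \<omega> / d"
      using Y0[of \<omega>] d by simp
    then have N: "real N \<le> Y \<omega> / d" "Y \<omega> / d \<le> 1 + real N"
      unfolding N_def by linarith+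
    have "\<omega> \<in> E m" if "m < N" for m
    proof -
      have "real (Suc m) \<le> Y \<omega> / d"
        using that N(1) by linarith
      then show ?thesis
        using \<open>\<omega> \<in> space M\<close> d by (simp add: E_def field_simps)
    qed
    then have "(\<Sum>m<N. indicator (E m) \<omega>) = (of_nat N :: ennreal)"
      by simp
    then have le: "of_nat N \<le> (\<Sum>m. indicator (E m) \<omega> :: ennreal)"
      using sum_le_suminf[of "\<lambda>m. indicator (E m) \<omega> :: ennreal" "{..<N}"] by simp
    have "Y \<omega> \<le> d * (1 + real N)"
      using N(2) d by (simp add: field_simps)
    then have "ennreal (Y \<omega>) \<le> ennreal (d * (1 + real N))"
      by (rule ennreal_leI)
    also have "\<dots> = ennreal d * (1 + of_nat N)"
      using d by (simp add: ennreal_mult ennreal_of_nat_eq_real_of_nat)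
    also have "\<dots> \<le> ennreal d * (1 + (\<Sum>m. indicator (E m) \<omega>))"
      by (intro mult_left_mono add_left_mono le) simp
    finally show ?thesis .
  qed
  have q: "exp (- B) < 1" "0 < exp (- B)"
    using B by auto
  have geo: "(\<lambda>m. A * exp (- B) * exp (- B) ^ m) sums (A * exp (- B) * (1 / (1 - exp (- B))))"
    by (intro sums_mult geometric_sums) (use q in simp)
  have probE: "prob (E m) \<le> A * exp (- B) * exp (- B) ^ m" for m
  proof -
    have "prob (E m) \<le> A * exp (- B * (real (Suc m))\<^sup>2)"
      using tail[of "real (Suc m) * d"] d unfolding E_def by simp
    also have "\<dots> \<le> A * exp (- B * real (Suc m))"
    proof -
      have "real (Suc m) * 1 \<le> real (Suc m) * real (Suc m)"
        by (intro mult_left_mono) auto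
      then show ?thesis
        using A B by (intro mult_left_mono) (auto simp: power2_eq_square)
    qed
    also have "\<dots> = A * exp (- B) * exp (- B) ^ m"
      by (simp add: exp_of_nat_mult[symmetric] exp_add[symmetric] algebra_simps)
    finally show ?thesis .
  qed
  have geo_bound: "A * exp (- B) * (1 / (1 - exp (- B))) \<le> A / B"
  proof -
    have "1 + B \<le> exp B"
      by (rule exp_ge_add_one_self)
    then have "exp (- B) * (1 / (1 - exp (- B))) \<le> 1 / B"
      using B q by (simp add: exp_minus divide_simps add.commute)
    from mult_left_mono[OF this A] show ?thesis
      by simp
  qed
  have "(\<integral>\<^sup>+\<omega>. ennreal (Y \<omega>) \<partial>M) \<le> (\<integral>\<^sup>+\<omega>. ennreal d * (1 + (\<Sum>m. indicator (E m) \<omega>)) \<partial>M)"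
    by (intro nn_integral_mono layer)
  also have "\<dots> = ennreal d * (1 + (\<Sum>m. emeasure M (E m)))"
    by (simp add: nn_integral_cmult nn_integral_add nn_integral_suminf emeasure_space_1)
  also have "(\<Sum>m. emeasure M (E m)) \<le> (\<Sum>m. ennreal (A * exp (- B) * exp (- B) ^ m))"
    using probE by (intro suminf_le) (auto simp: emeasure_eq_measure intro!: ennreal_leI)
  also have "\<dots> = ennreal (A * exp (- B) * (1 / (1 - exp (- B))))"
    using geo A by (intro suminf_ennreal_eq) auto
  also have "\<dots> \<le> ennreal (A / B)"
    by (intro ennreal_leI geo_bound)
  finally have nn: "(\<integral>\<^sup>+\<omega>. ennreal (Y \<omega>) \<partial>M) \<le> ennreal ((1 + A / B) * d)"
    using A B d by (simp add: ennreal_mult mult.commute add_mono mult_left_mono)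
  show int: "integrable M Y"
    using nn Y0 by (intro integrableI_nonneg) (auto simp: less_top[symmetric] top_unique)
  have "ennreal (expectation Y) = (\<integral>\<^sup>+\<omega>. ennreal (Y \<omega>) \<partial>M)"
    using int Y0 by (intro nn_integral_eq_integral[symmetric]) auto
  with nn have "ennreal (expectation Y) \<le> ennreal ((1 + A / B) * d)"
    by simp
  moreover have "0 \<le> (1 + A / B) * d"
    using A B d by simp
  ultimately show "expectation Y \<le> (1 + A / B) * d"
    by (simp only: ennreal_le_iff)
qed

section \<open>Discrete norms\<close>

lemma tau_norm_nonneg: "0 \<le> tau_norm a b n p v"
proof (cases "p = \<infinity>")
  case True
  have "0 \<le> \<bar>v 0\<bar>"
    by simp
  also have "\<bar>v 0\<bar> \<le> Max ((\<lambda>k. \<bar>v k\<bar>) ` {0..n})"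
    by (rule Max_ge) auto
  also have "\<dots> = tau_norm a b n p v"
    unfolding tau_norm_def True if_P[OF refl] ..
  finally show ?thesis .
qed (simp add: tau_norm_def)

text \<open>
  For finite \<open>p\<close> the norm is at most \<open>(b - a) powr (1 / p) * u\<close>; the factor
  \<open>max 1 (b - a)\<close> dominates it uniformly in \<open>p\<close>.
\<close>

lemma tau_norm_le:
  assumes ab: "a < b" and n: "1 \<le> n" and p: "1 \<le> p" and v: "\<And>k. k \<le> n \<Longrightarrow> \<bar>v k\<bar> \<le> u"
  shows "tau_norm a b n p v \<le> max 1 (b - a) * u"
proof -
  define D where "D = max 1 (b - a)"
  have D: "1 \<le> D" "b - a \<le> D"
    by (auto simp: D_def)
  have u: "0 \<le> u"
    using v[of 0] by simp
  show ?thesis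
  proof (cases "p = \<infinity>")
    case True
    have "Max ((\<lambda>k. \<bar>v k\<bar>) ` {0..n}) \<le> u"
      using v by (intro Max.boundedI) auto
    also have "\<dots> \<le> D * u"
      using D u by (simp add: mult_le_cancel_right1)
    finally show ?thesis
      using True by (simp add: tau_norm_def D_def)
  next
    case False
    then obtain r where r: "p = ereal r" "1 \<le> r"
      using p by (cases p) auto
    let ?S = "\<Sum>k<n. \<bar>v k\<bar> powr r + \<bar>v (k + 1)\<bar> powr r"
    have "?S \<le> (\<Sum>k<n. u powr r + u powr r)"
      using r v by (intro sum_mono add_mono powr_mono2) auto
    then have "(b - a) / (2 * real n) * ?S \<le> (b - a) / (2 * real n) * (2 * real n * u powr r)"
      using ab by (intro mult_left_mono) auto
    also have "\<dots> = (b - a) * u powr r"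
      using n by simp
    also have "\<dots> \<le> D powr r * u powr r"
      using powr_mono[of 1 r D] D r by (intro mult_right_mono) auto
    also have "\<dots> = (D * u) powr r"
      using D u by (simp add: powr_mult)
    finally have "((b - a) / (2 * real n) * ?S) powr (1 / r) \<le> ((D * u) powr r) powr (1 / r)"
      using ab r by (intro powr_mono2 mult_nonneg_nonneg sum_nonneg) auto
    also have "\<dots> = D * u"
      using D u r by (simp add: powr_powr)
    finally show ?thesis
      using r by (simp add: tau_norm_def D_def)
  qed
qed

lemma trapezoidal_sum_eq_partial_sums:
  fixes x :: "nat \<Rightarrow> real"
  shows "(\<Sum>j<Suc k. x j + x (j + 1)) = x 0 + (\<Sum>j=1..k. x j) + (\<Sum>j=1..Suc k. x j)"
  by (induction k) auto

lemma abs_volterra_le: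
  assumes ab: "a < b" and x0: "\<bar>x 0\<bar> \<le> u" and S: "\<And>k. k \<in> {1..n} \<Longrightarrow> \<bar>\<Sum>j=1..k. x j\<bar> \<le> u"
    and k: "k \<le> n"
  shows "\<bar>volterra a b n x k\<bar> \<le> (b - a) / (2 * real n) * (3 * u)"
proof -
  have u: "0 \<le> u"
    using x0 by simp
  have S': "\<bar>\<Sum>j=1..i. x j\<bar> \<le> u" if "i \<le> n" for i
    using S[of i] that u by (cases "i = 0") auto
  have "\<bar>\<Sum>j<k. x j + x (j + 1)\<bar> \<le> 3 * u"
  proof (cases k)
    case (Suc i)
    show ?thesis
      unfolding Suc trapezoidal_sum_eq_partial_sums using x0 S'[of i] S'[of "Suc i"] k Suc by linarith
  qed (use u in simp)
  then show ?thesis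
    unfolding volterra_def abs_mult using ab
    by (intro mult_mono) auto
qed

text \<open>
  The mean of \<open>x\<close> is, up to the factor \<open>b - a\<close>, the last Volterra sum. Centering therefore
  subtracts the chord joining \<open>0\<close> to that last value, and this is why it can at most double the
  maximum.
\<close>

lemma volterra_centered:
  assumes n: "1 \<le> n"
  shows "volterra a b n (centered n x) k
    = volterra a b n x k - real k / real n * volterra a b n x n"
proof -
  have "(\<Sum>j<k. centered n x j + centered n x (j + 1))
      = (\<Sum>j<k. x j + x (j + 1)) - real k * (2 * trap_mean n x)"
    by (simp add: centered_def sum_subtractf sum.distrib algebra_simps)
  then show ?thesis
    using n unfolding volterra_def trap_mean_def by (simp add: right_diff_distrib mult_ac)
qed

lemma nu_norm_le:
  assumes ab: "a < b" and n: "1 \<le> n" and p: "1 \<le> p"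
    and x0: "\<bar>x 0\<bar> \<le> u" and S: "\<And>k. k \<in> {1..n} \<Longrightarrow> \<bar>\<Sum>j=1..k. x j\<bar> \<le> u"
    and F: "F \<in> {\<lambda>n w. w, \<lambda>n w. centered n w}"
  shows "nu_norm a b n p (F n x) \<le> max 1 (b - a) * (3 * (b - a) * u / real n)"
  unfolding nu_norm_def
proof (rule tau_norm_le[OF ab n p])
  fix k assume k: "k \<le> n"
  let ?L = "(b - a) / (2 * real n) * (3 * u)"
  have V: "\<bar>volterra a b n x i\<bar> \<le> ?L" if "i \<le> n" for i
    using abs_volterra_le[OF ab x0 S that] by blast
  have "\<bar>real k / real n * volterra a b n x n\<bar> \<le> 1 * ?L"
    unfolding abs_mult using V[of n] k n by (intro mult_mono) auto
  then have "\<bar>volterra a b n (centered n x) k\<bar> \<le> 2 * ?L"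
    unfolding volterra_centered[OF n] mult_2
    using V[OF k] by (intro order_trans[OF abs_triangle_ineq4] add_mono) simp_all
  moreover have "\<bar>volterra a b n x k\<bar> \<le> 2 * ?L"
    using V[OF k] abs_ge_zero[of "volterra a b n x k"] by linarith
  ultimately have "\<bar>volterra a b n (F n x) k\<bar> \<le> 2 * ?L"
    using F by (elim insertE emptyE) (simp_all only:)
  also have "2 * ?L = 3 * (b - a) * u / real n"
    by simp
  finally show "\<bar>volterra a b n (F n x) k\<bar> \<le> 3 * (b - a) * u / real n" .
qed

lemma borel_measurable_nu_norm:
  assumes [measurable]: "\<And>j. x j \<in> borel_measurable M"
    and F: "F \<in> {\<lambda>n w. w, \<lambda>n w. centered n w}"
  shows "(\<lambda>\<omega>. nu_norm a b n p (F n (\<lambda>j. x j \<omega>))) \<in> borel_measurable M"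
proof -
  have [measurable]: "(\<lambda>\<omega>. F n (\<lambda>j. x j \<omega>) k) \<in> borel_measurable M" for k
    using F by (auto simp: centered_def trap_mean_def)
  have [measurable]: "(\<lambda>\<omega>. volterra a b n (F n (\<lambda>j. x j \<omega>)) k) \<in> borel_measurable M" for k
    unfolding volterra_def by measurable
  show ?thesis
    unfolding nu_norm_def tau_norm_def by (cases "p = \<infinity>") (simp_all, measurable)
qed

section \<open>Concentration of the Volterra norm of Gaussian noise\<close>

text \<open>
  The factor \<open>max 1 (K\<^sup>2)\<close> lets one number \<open>max 1 (K\<^sup>2) * n * \<sigma>\<^sup>2\<close> bound both the variance of
  \<open>Z 0\<close> and that of the full sum, so that the two tails add up to a single exponential with
  coefficient \<open>2 + 4 = 6\<close>.
\<close>

lemma (in prob_space) nu_norm_gaussian_tail: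
  fixes Z :: "nat \<Rightarrow> 'a \<Rightarrow> real"
  assumes ab: "a < b" and s: "\<And>j. 0 < s j"
    and indep: "indep_vars (\<lambda>_. borel) Z UNIV"
    and Z: "\<And>j. distributed M lborel (Z j) (normal_density 0 (s j))"
    and \<sigma>: "0 < \<sigma>" and n: "1 \<le> n"
    and var: "1 / real n * (\<Sum>j=1..n. (s j)\<^sup>2) \<le> \<sigma>\<^sup>2"
    and s0: "s 0 \<le> K * \<sigma>" and p: "1 \<le> p"
    and F: "F \<in> {\<lambda>n w. w, \<lambda>n w. centered n w}" and t: "0 < t"
  shows "prob {\<omega> \<in> space M. t \<le> nu_norm a b n p (F n (\<lambda>j. Z j \<omega>))}
    \<le> 6 * exp (- (1 / (32 * (max 1 (b - a))\<^sup>2 * (b - a)\<^sup>2 * max 1 (K\<^sup>2))) * t\<^sup>2 * real n / \<sigma>\<^sup>2)"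
proof -
  define D where "D = max 1 (b - a)"
  define L where "L = max 1 (K\<^sup>2)"
  have D: "1 \<le> D" and L: "1 \<le> L" "K\<^sup>2 \<le> L"
    by (auto simp: D_def L_def)
  \<comment> \<open>With this level, the bound of \<open>nu_norm_le\<close> is \<open>3 / 4 * t\<close>, strictly less than \<open>t\<close>.\<close>
  define u where "u = t * real n / (4 * D * (b - a))"
  have u: "0 < u"
    using t n D ab by (simp add: u_def)
  have [measurable]: "Z j \<in> borel_measurable M" for j
    using distributed_measurable[OF Z] by simp
  let ?E0 = "{\<omega> \<in> space M. u \<le> \<bar>Z 0 \<omega>\<bar>}"
  let ?ES = "{\<omega> \<in> space M. \<exists>k\<in>{1..n}. u \<le> \<bar>\<Sum>j=1..k. Z j \<omega>\<bar>}"
  have "{\<omega> \<in> space M. t \<le> nu_norm a b n p (F n (\<lambda>j. Z j \<omega>))} \<subseteq> ?E0 \<union> ?ES"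
  proof (rule subsetI, rule ccontr)
    fix \<omega>
    assume \<omega>: "\<omega> \<in> {\<omega> \<in> space M. t \<le> nu_norm a b n p (F n (\<lambda>j. Z j \<omega>))}"
      and "\<omega> \<notin> ?E0 \<union> ?ES"
    then have "\<bar>Z 0 \<omega>\<bar> \<le> u" "\<And>k. k \<in> {1..n} \<Longrightarrow> \<bar>\<Sum>j=1..k. Z j \<omega>\<bar> \<le> u"
      by force+
    from nu_norm_le[OF ab n p this F]
    have "nu_norm a b n p (F n (\<lambda>j. Z j \<omega>)) \<le> D * (3 * (b - a) * u / real n)"
      by (simp add: D_def)
    also have "\<dots> = 3 / 4 * t"
      using D ab n by (simp add: u_def field_simps)
    finally show False
      using \<omega> t by simp
  qed
  then have "prob {\<omega> \<in> space M. t \<le> nu_norm a b n p (F n (\<lambda>j. Z j \<omega>))} \<le> prob (?E0 \<union> ?ES)"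
    by (rule finite_measure_mono) measurable
  also have "\<dots> \<le> prob ?E0 + prob ?ES"
    by (rule measure_Un_le) measurable
  also have "\<dots> \<le> 2 * exp (- u\<^sup>2 / (2 * (s 0)\<^sup>2)) + 4 * exp (- u\<^sup>2 / (2 * (\<Sum>j=1..n. (s j)\<^sup>2)))"
    using u s Z n indep
    by (intro add_mono normal_abs_tail_le normal_partial_sums_tail indep_vars_subset[OF indep]) auto
  also have "\<dots> \<le> 2 * exp (- u\<^sup>2 / (2 * (L * real n * \<sigma>\<^sup>2))) + 4 * exp (- u\<^sup>2 / (2 * (L * real n * \<sigma>\<^sup>2)))"
  proof -
    have n\<sigma>: "0 < real n * \<sigma>\<^sup>2"
      using n \<sigma> by simp
    have mono: "exp (- u\<^sup>2 / (2 * v)) \<le> exp (- u\<^sup>2 / (2 * W))" if "0 < v" "v \<le> W" for v W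
      using that by (auto intro!: divide_left_mono)
    have "(s 0)\<^sup>2 \<le> (K * \<sigma>)\<^sup>2"
      using s[of 0] s0 by (intro power_mono) auto
    also have "\<dots> = K\<^sup>2 * (1 * \<sigma>\<^sup>2)"
      by (simp add: power_mult_distrib)
    also have "\<dots> \<le> L * (real n * \<sigma>\<^sup>2)"
      using L n by (intro mult_mono) auto
    finally have v0: "(s 0)\<^sup>2 \<le> L * real n * \<sigma>\<^sup>2"
      by (simp add: mult.assoc)
    have "(\<Sum>j=1..n. (s j)\<^sup>2) \<le> 1 * (real n * \<sigma>\<^sup>2)"
      using var n by (simp add: field_simps)
    also have "\<dots> \<le> L * (real n * \<sigma>\<^sup>2)"
      using L n\<sigma> by (intro mult_right_mono) auto
    finally have v1: "(\<Sum>j=1..n. (s j)\<^sup>2) \<le> L * real n * \<sigma>\<^sup>2"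
      by (simp add: mult.assoc)
    have "0 < (\<Sum>j=1..n. (s j)\<^sup>2)"
      using n s by (intro sum_pos zero_less_power) auto
    then show ?thesis
      using s[of 0] v0 v1 by (intro add_mono mult_left_mono mono) auto
  qed
  also have "\<dots> = 6 * exp (- u\<^sup>2 / (2 * (L * real n * \<sigma>\<^sup>2)))"
    by simp
  also have "- u\<^sup>2 / (2 * (L * real n * \<sigma>\<^sup>2)) = - (1 / (32 * D\<^sup>2 * (b - a)\<^sup>2 * L)) * t\<^sup>2 * real n / \<sigma>\<^sup>2"
    using n D L \<sigma> ab by (simp add: u_def power2_eq_square divide_simps)
  finally show ?thesis
    by (simp only: D_def L_def)
qed

theorem theorem5p3:
  fixes a b K :: real
  assumes "a < b"
  shows "\<exists>A>0. \<exists>B>0. \<exists>C>0.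
    \<forall>(M :: 'w measure) (Z :: nat \<Rightarrow> 'w \<Rightarrow> real) (s :: nat \<Rightarrow> real) (\<sigma> :: real).
      prob_space M \<longrightarrow>
      (\<forall>j. s j > 0) \<longrightarrow>
      prob_space.indep_vars M (\<lambda>_. borel) Z UNIV \<longrightarrow>
      (\<forall>j. distributed M lborel (Z j) (normal_density 0 (s j))) \<longrightarrow>
      \<sigma> > 0 \<longrightarrow>
      (\<forall>n\<ge>1. 1 / real n * (\<Sum>j=1..n. (s j)\<^sup>2) \<le> \<sigma>\<^sup>2) \<longrightarrow>
      s 0 \<le> K * \<sigma> \<longrightarrow>
      (\<forall>p::ereal. 1 \<le> p \<longrightarrow>
        (\<forall>F \<in> {\<lambda>n w. w, \<lambda>n w. centered n w}.
          (\<forall>n\<ge>1. \<forall>t>0.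
             measure M {\<omega> \<in> space M. nu_norm a b n p (F n (\<lambda>j. Z j \<omega>)) \<ge> t}
               \<le> A * exp (- B * t\<^sup>2 * real n / \<sigma>\<^sup>2)) \<and>
          (AE \<omega> in M. (\<lambda>n. nu_norm a b n p (F n (\<lambda>j. Z j \<omega>))) \<longlonglongrightarrow> 0) \<and>
          (\<forall>n\<ge>1.
             integrable M (\<lambda>\<omega>. nu_norm a b n p (F n (\<lambda>j. Z j \<omega>))) \<and>
             (\<integral>\<omega>. nu_norm a b n p (F n (\<lambda>j. Z j \<omega>)) \<partial>M) \<le> C * \<sigma> / sqrt (real n))))"
proof -
  define B where "B = 1 / (32 * (max 1 (b - a))\<^sup>2 * (b - a)\<^sup>2 * max 1 (K\<^sup>2))"
  have D: "0 < max 1 (b - a)" and L: "0 < max 1 (K\<^sup>2)"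
    by (auto simp: less_max_iff_disj)
  have B: "0 < B"
    unfolding B_def using D L assms by (intro divide_pos_pos mult_pos_pos zero_less_power) auto
  have C: "0 < 1 + 6 / B"
    using B by (simp add: add_pos_pos)
  show ?thesis
  proof (rule exI[of _ 6], intro conjI, simp, rule exI[of _ B], intro conjI, rule B,
      rule exI[of _ "1 + 6 / B"], rule conjI[OF C], intro allI impI ballI)
    fix M :: "'w measure" and Z :: "nat \<Rightarrow> 'w \<Rightarrow> real" and s :: "nat \<Rightarrow> real" and \<sigma> :: real
      and p :: ereal and F :: "nat \<Rightarrow> (nat \<Rightarrow> real) \<Rightarrow> nat \<Rightarrow> real"
    assume "prob_space M"
    then interpret prob_space M .
    assume s: "\<forall>j. s j > 0" and indep: "indep_vars (\<lambda>_. borel) Z UNIV"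
      and Z: "\<forall>j. distributed M lborel (Z j) (normal_density 0 (s j))"
      and \<sigma>: "\<sigma> > 0" and var: "\<forall>n\<ge>1. 1 / real n * (\<Sum>j=1..n. (s j)\<^sup>2) \<le> \<sigma>\<^sup>2"
      and s0: "s 0 \<le> K * \<sigma>" and p: "1 \<le> p"
      and F: "F \<in> {\<lambda>n w. w, \<lambda>n w. centered n w}"
    let ?N = "\<lambda>n \<omega>. nu_norm a b n p (F n (\<lambda>j. Z j \<omega>))"
    have "Z j \<in> borel_measurable M" for j
      using distributed_measurable[OF Z[rule_format]] by simp
    then have meas: "?N n \<in> borel_measurable M" for n
      by (intro borel_measurable_nu_norm F)
    have nonneg: "0 \<le> ?N n \<omega>" for n \<omega>
      unfolding nu_norm_def by (rule tau_norm_nonneg)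
    have tail: "prob {\<omega> \<in> space M. t \<le> ?N n \<omega>} \<le> 6 * exp (- B * t\<^sup>2 * real n / \<sigma>\<^sup>2)"
      if "1 \<le> n" "0 < t" for n t
      unfolding B_def using assms s indep Z \<sigma> var s0 p F that
      by (intro nu_norm_gaussian_tail[where s = s]) auto
    have "AE \<omega> in M. (\<lambda>n. ?N n \<omega>) \<longlonglongrightarrow> 0"
    proof (rule AE_tendsto_zero_of_gaussian_tails[where c = "B / \<sigma>\<^sup>2" and A = 6])
      show "prob {\<omega> \<in> space M. t \<le> ?N n \<omega>} \<le> 6 * exp (- (B / \<sigma>\<^sup>2) * t\<^sup>2 * real n)"
        if "1 \<le> n" "0 < t" for n t
        using tail[OF that] by (simp add: mult.assoc)
    qed (use meas nonneg B \<sigma> in auto)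
    moreover have "integrable M (?N n) \<and> expectation (?N n) \<le> (1 + 6 / B) * \<sigma> / sqrt (real n)"
      if n: "1 \<le> n" for n
    proof -
      have d: "0 < \<sigma> / sqrt (real n)"
        using \<sigma> n by simp
      have "- B * (t / (\<sigma> / sqrt (real n)))\<^sup>2 = - B * t\<^sup>2 * real n / \<sigma>\<^sup>2" for t
        by (simp add: power_divide power_mult_distrib)
      then have "prob {\<omega> \<in> space M. t \<le> ?N n \<omega>} \<le> 6 * exp (- B * (t / (\<sigma> / sqrt (real n)))\<^sup>2)"
        if "0 < t" for t
        using tail[OF n that] by simp
      from expectation_le_of_gaussian_tail[OF meas nonneg d B _ this] show ?thesis
        by simp
    qed
    ultimately show "(\<forall>n\<ge>1. \<forall>t>0. prob {\<omega> \<in> space M. ?N n \<omega> \<ge> t}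
          \<le> 6 * exp (- B * t\<^sup>2 * real n / \<sigma>\<^sup>2)) \<and>
        (AE \<omega> in M. (\<lambda>n. ?N n \<omega>) \<longlonglongrightarrow> 0) \<and>
        (\<forall>n\<ge>1. integrable M (?N n) \<and> expectation (?N n) \<le> (1 + 6 / B) * \<sigma> / sqrt (real n))"
      using tail by blast
  qed
qed

end
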